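(* Let $S$ be a finite set of points in the plane $\mathbb{R}^2$. Then $\bigcup_{i \geq 0} \mathcal{T}^{i}(S)$ is dense in $\mathbb{R}^2$ if and only if $S$ is not one of the following sets: (1) the empty set; (2) a set of collinear points; (3) a set of collinear points together with one additional point not collinear with them; (4) the set of vertices of a parallelogram; (5) the set consisting of the vertices of a parallelogram and the intersection point of its two diagonals.
   Context: For a set $S \subseteq \mathbb{R}^2$, let $L = \{L_i\}_{i\in I}$ be the set of lines passing through pairs of (distinct) points of $S$. Define $\mathcal{T}(S) = \bigcup_{i \neq j} L_i \cap L_j \subseteq \mathbb{R}^2$, i.e. the set of intersection points between pairs of distinct lines in $L$. If $S$ is empty or consists of collinear points, then $\mathcal{T}(S) = \emptyset$. The iterates are $\mathcal{T}^0(S) = S$ and $\mathcal{T}^{i+1}(S) = \mathcal{T}(\mathcal{T}^i(S))$. Parallelograms are nondegenerate. *)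

theory Defs
  imports "HOL-Analysis.Analysis"
begin

definition connecting_lines :: "(real^2) set \<Rightarrow> (real^2) set set" where
  "connecting_lines S = {affine hull {p, q} | p q. p \<in> S \<and> q \<in> S \<and> p \<noteq> q}"

(* The family of connecting lines is a set of lines, so a line containing three or more
   points of S occurs only once and is never intersected with itself. *)
definition line_intersections :: "(real^2) set \<Rightarrow> (real^2) set" where
  "line_intersections S =
     \<Union>{L \<inter> M | L M. L \<in> connecting_lines S \<and> M \<in> connecting_lines S \<and> L \<noteq> M}"

(* Vertices in cyclic order. Non-collinearity of a, b, c is the nondegeneracy condition;
   as parallel affine sets have the same dimension, it also forces c \<noteq> d and a \<noteq> d,
   and hence all four vertices are distinct. *)
definition parallelogram :: "real^2 \<Rightarrow> real^2 \<Rightarrow> real^2 \<Rightarrow> real^2 \<Rightarrow> bool" where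
  "parallelogram a b c d \<longleftrightarrow>
     \<not> collinear {a, b, c} \<and>
     affine_parallel (affine hull {a, b}) (affine hull {c, d}) \<and>
     affine_parallel (affine hull {b, c}) (affine hull {a, d})"

end

theory Submission
  imports Defs
begin

text \<open>
  If the points of \<open>S\<close> are not collinear, then \<open>S\<close> is contained in its set of line
  intersections, so the iterates increase and their union \<open>U\<close> is closed: whenever two
  distinct lines joining points of \<open>U\<close> meet, they meet in a point of \<open>U\<close>
  (\<open>meet_closed_iterates\<close>). What has to be shown is that such a \<open>U\<close> is dense.

  The heart of the matter is a triangle of \<open>U\<close> with a point \<open>d\<close> of \<open>U\<close> in its interior. A
  projective map sends the three vertices to the two points at infinity of the axes and the
  origin, and \<open>d\<close> to \<open>(1, 1)\<close>; the triangle becomes the closed positive quadrant. All points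
  of the quadrant with rational coordinates arise from these four by joining and
  intersecting without leaving the quadrant: horizontals, verticals and lines of slope one
  produce the integer grid, and lines from the origin through grid points produce all
  rational slopes. Staying in the quadrant matters, since its points are the images of finite
  points, while elsewhere an intersection may be lost at infinity. Every other rational point
  lies on two lines that pass through the quadrant, so it too belongs to \<open>U\<close> unless it is at
  infinity, and density follows (\<open>inner_frame_dense\<close>). The projective map is never written
  down: it is encoded in homogeneous coordinates, where joining and intersecting become
  linear algebra.

  A quadrangle that is not a parallelogram yields such a triangle. Either one of its points
  is interior to the triangle of the other three; or it is convex, two opposite sides meet in
  a point outside, and this point together with the two farther ones of the four vertices
  spans a triangle whose interior contains the intersection of the diagonals
  (\<open>quadrangle_dense\<close>). A parallelogram together with a fifth point other than its centre also
  yields one: projecting the fifth point from a vertex gives a new point on a diagonal, and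
  this makes one of the points on that diagonal interior to a triangle
  (\<open>parallelogram_extra_dense\<close>).

  Finally, a non-collinear set that is not a line plus one point contains four points in
  general position (\<open>quadrangle_or_pencil\<close>), and the preceding cases apply. Conversely every
  exceptional set is contained in a finite set that forming intersections does not enlarge.
\<close>

section \<open>Closed sets in homogeneous coordinates\<close>

definition meet_closed :: "(real^2) set \<Rightarrow> bool" where
  "meet_closed U \<longleftrightarrow> line_intersections U \<subseteq> U"

lemma meet_closedD:
  assumes "meet_closed U" "p \<in> U" "q \<in> U" "p \<noteq> q" "r \<in> U" "s \<in> U" "r \<noteq> s"
    and "affine hull {p, q} \<noteq> affine hull {r, s}"
    and "x \<in> affine hull {p, q}" "x \<in> affine hull {r, s}"
  shows "x \<in> U"
proof -
  have "affine hull {p, q} \<in> connecting_lines U" "affine hull {r, s} \<in> connecting_lines U"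
    using assms unfolding connecting_lines_def by blast+
  then have "x \<in> line_intersections U"
    unfolding line_intersections_def using assms by blast
  then show ?thesis using assms(1) unfolding meet_closed_def by blast
qed

text \<open>
  The pair \<open>(v, s)\<close> with \<open>s \<noteq> 0\<close> represents the point \<open>v / s\<close> of the plane, and pairs with
  \<open>s = 0\<close> represent points at infinity. The set \<open>hpoints U\<close> consists of all representatives
  of points of \<open>U\<close>.
\<close>

definition lift :: "real^2 \<Rightarrow> (real^2) \<times> real" where
  "lift p = (p, 1)"

definition hpoints :: "(real^2) set \<Rightarrow> ((real^2) \<times> real) set" where
  "hpoints U = {X. snd X \<noteq> 0 \<and> fst X /\<^sub>R snd X \<in> U}"

definition det3 :: "(real^2) \<times> real \<Rightarrow> (real^2) \<times> real \<Rightarrow> (real^2) \<times> real \<Rightarrow> real" where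
  "det3 X Y Z =
     fst X $ 1 * (fst Y $ 2 * snd Z - snd Y * fst Z $ 2)
   - fst X $ 2 * (fst Y $ 1 * snd Z - snd Y * fst Z $ 1)
   + snd X * (fst Y $ 1 * fst Z $ 2 - fst Y $ 2 * fst Z $ 1)"

lemma det3_linear:
  "det3 (X + X') Y Z = det3 X Y Z + det3 X' Y Z"
  "det3 X (Y + Y') Z = det3 X Y Z + det3 X Y' Z"
  "det3 X Y (Z + Z') = det3 X Y Z + det3 X Y Z'"
  "det3 (X - X') Y Z = det3 X Y Z - det3 X' Y Z"
  "det3 X (Y - Y') Z = det3 X Y Z - det3 X Y' Z"
  "det3 X Y (Z - Z') = det3 X Y Z - det3 X Y Z'"
  "det3 (k *\<^sub>R X) Y Z = k * det3 X Y Z"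
  "det3 X (k *\<^sub>R Y) Z = k * det3 X Y Z"
  "det3 X Y (k *\<^sub>R Z) = k * det3 X Y Z"
  by (simp_all add: det3_def algebra_simps)

lemma det3_alternating [simp]:
  "det3 X X Y = 0" "det3 X Y X = 0" "det3 Y X X = 0"
  by (simp_all add: det3_def algebra_simps)

lemma det3_nonzero_perm:
  assumes "det3 X Y Z \<noteq> 0"
  shows "det3 X Y Z \<noteq> 0" "det3 X Z Y \<noteq> 0" "det3 Y X Z \<noteq> 0" "det3 Y Z X \<noteq> 0" "det3 Z X Y \<noteq> 0" "det3 Z Y X \<noteq> 0"
  using assms by (auto simp: det3_def algebra_simps)

text \<open>
  Cramer's rule: three independent representatives are projective coordinates for all points.
\<close>

lemma cramer:
  assumes "det3 A B C \<noteq> 0"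
  shows "P = (det3 P B C / det3 A B C) *\<^sub>R A + (det3 A P C / det3 A B C) *\<^sub>R B
           + (det3 A B P / det3 A B C) *\<^sub>R C"
proof -
  have "det3 A B C *\<^sub>R P = det3 P B C *\<^sub>R A + det3 A P C *\<^sub>R B + det3 A B P *\<^sub>R C"
    by (simp add: prod_eq_iff vec_eq_iff forall_2 det3_def algebra_simps)
  then have "(1 / det3 A B C) *\<^sub>R (det3 A B C *\<^sub>R P)
    = (1 / det3 A B C) *\<^sub>R (det3 P B C *\<^sub>R A + det3 A P C *\<^sub>R B + det3 A B P *\<^sub>R C)"
    by simp
  then show ?thesis
    using assms by (simp add: scaleR_add_right)
qed

lemma lift_simps [simp]: "fst (lift p) = p" "snd (lift p) = 1"
  by (simp_all add: lift_def)

lemma hpoints_lift [simp]: "lift p \<in> hpoints U \<longleftrightarrow> p \<in> U"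
  by (simp add: hpoints_def)

lemma hpoints_scale: "k \<noteq> 0 \<Longrightarrow> k *\<^sub>R X \<in> hpoints U \<longleftrightarrow> X \<in> hpoints U"
  by (simp add: hpoints_def field_simps)

lemma hpointsE:
  assumes "X \<in> hpoints U"
  obtains k p where "k \<noteq> 0" "p \<in> U" "X = k *\<^sub>R lift p"
proof
  show "snd X \<noteq> 0" "fst X /\<^sub>R snd X \<in> U" "X = snd X *\<^sub>R lift (fst X /\<^sub>R snd X)"
    using assms by (auto simp: hpoints_def prod_eq_iff)
qed

text \<open>
  The determinant is the oriented area spanned by \<open>b - a\<close> and \<open>c - a\<close>, and it vanishes exactly
  in the equality case of the Cauchy-Schwarz inequality, by Lagrange's identity.
\<close>

lemma collinear_iff_det3: "collinear {a, b, c} \<longleftrightarrow> det3 (lift a) (lift b) (lift c) = 0"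
proof -
  let ?x = "b - a" and ?y = "c - a"
  have "collinear {a, b, c} \<longleftrightarrow> collinear {b, a, c}"
    by (simp add: insert_commute)
  also have "\<dots> \<longleftrightarrow> collinear {0, ?x, ?y}"
    using collinear_3[of b a c] by simp
  also have "\<dots> \<longleftrightarrow> \<bar>?x \<bullet> ?y\<bar> = norm ?x * norm ?y"
    by (simp add: norm_cauchy_schwarz_equal)
  also have "\<dots> \<longleftrightarrow> (?x \<bullet> ?y)\<^sup>2 = (norm ?x)\<^sup>2 * (norm ?y)\<^sup>2"
    using power2_eq_iff_nonneg[of "\<bar>?x \<bullet> ?y\<bar>" "norm ?x * norm ?y"]
    by (auto simp: power_mult_distrib)
  also have "\<dots> \<longleftrightarrow> (det3 (lift a) (lift b) (lift c))\<^sup>2 = 0"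
  proof -
    have "(norm ?x)\<^sup>2 * (norm ?y)\<^sup>2 - (?x \<bullet> ?y)\<^sup>2 = (det3 (lift a) (lift b) (lift c))\<^sup>2"
      unfolding power2_norm_eq_inner det3_def inner_vec_def sum_2 lift_simps inner_real_def vector_minus_component
      by algebra
    then show ?thesis by linarith
  qed
  finally show ?thesis by simp
qed

lemma lift_affine_hull:
  "p \<in> affine hull {q, r} \<longleftrightarrow> (\<exists>u v. lift p = u *\<^sub>R lift q + v *\<^sub>R lift r)"
  unfolding affine_hull_2 lift_def prod_eq_iff by auto

text \<open>
  This is the form in which closedness is used throughout: a vector in the span of \<open>Y\<close> and \<open>Z\<close>
  and in the span of \<open>V\<close> and \<open>W\<close> represents the intersection of the two lines. The
  determinant says that \<open>V\<close> is off the first line, which makes the lines distinct; the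
  condition on \<open>snd X\<close> says that they do not meet at infinity. That \<open>V\<close> and \<open>W\<close> represent
  different points is then automatic, as otherwise \<open>V\<close> would be the intersection point.
\<close>

lemma hpoints_meet:
  assumes U: "meet_closed U"
    and G: "Y \<in> hpoints U" "Z \<in> hpoints U" "V \<in> hpoints U" "W \<in> hpoints U"
    and X1: "X = l *\<^sub>R Y + m *\<^sub>R Z" and X2: "X = r *\<^sub>R V + t *\<^sub>R W"
    and indep: "det3 Y Z V \<noteq> 0" and X0: "snd X \<noteq> 0"
  shows "X \<in> hpoints U"
proof -
  obtain y p where Y: "y \<noteq> 0" "p \<in> U" "Y = y *\<^sub>R lift p" using G(1) by (rule hpointsE)
  obtain z q where Z: "z \<noteq> 0" "q \<in> U" "Z = z *\<^sub>R lift q" using G(2) by (rule hpointsE)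
  obtain v a where V: "v \<noteq> 0" "a \<in> U" "V = v *\<^sub>R lift a" using G(3) by (rule hpointsE)
  obtain w b where W: "w \<noteq> 0" "b \<in> U" "W = w *\<^sub>R lift b" using G(4) by (rule hpointsE)
  define k where "k = snd X"
  define x where "x = fst X /\<^sub>R k"
  have X: "X = k *\<^sub>R lift x" and k: "k \<noteq> 0"
    using X0 by (auto simp: k_def x_def prod_eq_iff)
  have lx: "lift x = (1/k) *\<^sub>R X" using X k by simp
  have d: "det3 (lift p) (lift q) (lift a) \<noteq> 0"
    using indep by (auto simp: Y Z V det3_linear)
  have pq: "p \<noteq> q" using d by auto
  have xpq: "x \<in> affine hull {p, q}"
    unfolding lift_affine_hull lx X1 Y Z by (auto simp: scaleR_add_right)
  have xab: "x \<in> affine hull {a, b}"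
    unfolding lift_affine_hull lx X2 V W by (auto simp: scaleR_add_right)
  have a: "a \<notin> affine hull {p, q}"
    using d by (auto simp: lift_affine_hull det3_linear)
  have ab: "a \<noteq> b" using a xpq xab by auto
  have "affine hull {p, q} \<noteq> affine hull {a, b}"
    using a hull_subset[of "{a, b}" affine] by auto
  then have "x \<in> U"
    using meet_closedD[OF U Y(2) Z(2) pq V(2) W(2) ab _ xpq xab] by blast
  then show ?thesis unfolding X using k by (simp add: hpoints_scale)
qed

section \<open>Triangles with an interior point\<close>

text \<open>
  A triangle with an interior point, all four in \<open>U\<close>. The representatives of the vertices are
  scaled so that the interior point is represented by their sum; being interior means that
  the scaling factors are positive. Then every nonnegative combination other than zero
  represents a finite point, so intersections inside the triangle are never at infinity.
\<close>

definition inner_frame ::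
  "(real^2) set \<Rightarrow> (real^2) \<times> real \<Rightarrow> (real^2) \<times> real \<Rightarrow> (real^2) \<times> real \<Rightarrow> bool" where
  "inner_frame U A B C \<longleftrightarrow> A \<in> hpoints U \<and> B \<in> hpoints U \<and> C \<in> hpoints U \<and> A + B + C \<in> hpoints U
     \<and> 0 < snd A \<and> 0 < snd B \<and> 0 < snd C \<and> det3 A B C \<noteq> 0"

lemma inner_frame_perm:
  assumes "inner_frame U A B C"
  shows "inner_frame U B A C" "inner_frame U A C B" "inner_frame U B C A" "inner_frame U C B A"
  using assms det3_nonzero_perm[of A B C] by (auto simp: inner_frame_def add_ac)

text \<open>
  In the quadrant where \<open>x A + y B + C\<close> has coordinates \<open>(x, y)\<close>, these are the integer points
  on the axis \<open>y = 0\<close>. The vector \<open>A + B\<close> is the point at infinity of the lines of slope one;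
  the line of slope one through \<open>(n, 0)\<close> meets the line \<open>y = 1\<close> in \<open>(n + 1, 1)\<close>, which is then
  projected back along the vertical.
\<close>

lemma inner_frame_integers:
  assumes U: "meet_closed U" and fr: "inner_frame U A B C"
  shows "real n *\<^sub>R A + C \<in> hpoints U"
proof (induction n)
  case 0
  then show ?case using fr by (simp add: inner_frame_def)
next
  case (Suc n)
  have G: "A \<in> hpoints U" "B \<in> hpoints U" "C \<in> hpoints U" "A + B + C \<in> hpoints U"
    and pos: "0 < snd A" "0 < snd B" "0 < snd C" and "det3 A B C \<noteq> 0"
    using fr by (auto simp: inner_frame_def)
  note d = det3_nonzero_perm[OF \<open>det3 A B C \<noteq> 0\<close>]
  have AB: "A + B \<in> hpoints U"
    by (rule hpoints_meet[OF U G(1,2,3,4), where l=1 and m=1 and r="-1" and t=1])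
       (use pos d in auto)
  have BC: "B + C \<in> hpoints U"
    by (rule hpoints_meet[OF U G(2,3,1,4), where l=1 and m=1 and r="-1" and t=1])
       (use pos d in auto)
  have "(real n + 1) *\<^sub>R A + B + C \<in> hpoints U"
    by (rule hpoints_meet[OF U Suc AB G(1) BC, where l=1 and m=1 and r="real n + 1" and t=1])
       (use pos d in \<open>auto simp: algebra_simps det3_linear add_nonneg_eq_0_iff\<close>)
  then have "(real n + 1) *\<^sub>R A + C \<in> hpoints U"
    by (rule hpoints_meet[OF U G(1,3,2), where l="real n + 1" and m=1 and r="-1" and t=1])
       (use pos d in \<open>auto simp: algebra_simps det3_linear add_nonneg_eq_0_iff\<close>)
  then show ?case by (simp add: add.commute)
qed

text \<open>
  Horizontals and verticals through the integer points of the axes give the whole grid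
  \<open>(i, j)\<close>; the lines from the origin through the grid points meet the side \<open>A B\<close> in all points
  \<open>i A + j B\<close>, and by symmetry the same holds on the other two sides. A point of the triangle
  is the intersection of two lines from vertices to such points on the opposite sides.
\<close>

lemma inner_frame_nat_combination:
  assumes U: "meet_closed U" and fr: "inner_frame U A B C"
    and "(l, m, n) \<noteq> (0, 0, 0)"
  shows "real l *\<^sub>R A + real m *\<^sub>R B + real n *\<^sub>R C \<in> hpoints U"
proof -
  have fin: "real i *\<^sub>R A' + real j *\<^sub>R B' + C' \<in> hpoints U"
    if fr': "inner_frame U A' B' C'" for i j A' B' C'
  proof -
    have G: "A' \<in> hpoints U" "B' \<in> hpoints U" "C' \<in> hpoints U"
      and pos: "0 < snd A'" "0 < snd B'" "0 < snd C'" and "det3 A' B' C' \<noteq> 0"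
      using fr' by (auto simp: inner_frame_def)
    note d = det3_nonzero_perm[OF \<open>det3 A' B' C' \<noteq> 0\<close>]
    have A: "real i *\<^sub>R A' + C' \<in> hpoints U"
      by (rule inner_frame_integers[OF U fr'])
    have B: "real j *\<^sub>R B' + C' \<in> hpoints U"
      by (rule inner_frame_integers[OF U inner_frame_perm(1)[OF fr']])
    have s: "0 \<le> real i * snd A'" "0 \<le> real j * snd B'" using pos by auto
    have "snd (real i *\<^sub>R A' + real j *\<^sub>R B' + C') \<noteq> 0"
      using s pos(3) by (simp add: add_nonneg_pos less_imp_neq[THEN not_sym])
    then show ?thesis
      by (intro hpoints_meet[OF U A G(2) G(1) B, where l=1 and m="real j" and r="real i" and t=1])
         (use d in \<open>auto simp: algebra_simps det3_linear\<close>)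
  qed
  have edge: "real i *\<^sub>R A' + real j *\<^sub>R B' \<in> hpoints U"
    if fr': "inner_frame U A' B' C'" and ij: "i \<noteq> 0 \<or> j \<noteq> 0" for i j A' B' C'
  proof -
    have G: "A' \<in> hpoints U" "B' \<in> hpoints U" "C' \<in> hpoints U"
      and pos: "0 < snd A'" "0 < snd B'" "0 < snd C'" and "det3 A' B' C' \<noteq> 0"
      using fr' by (auto simp: inner_frame_def)
    note d = det3_nonzero_perm[OF \<open>det3 A' B' C' \<noteq> 0\<close>]
    have "snd (real i *\<^sub>R A' + real j *\<^sub>R B') \<noteq> 0"
      using pos ij by (auto simp: add_nonneg_eq_0_iff)
    then show ?thesis
      by (intro hpoints_meet[OF U G(1) G(2) G(3) fin[OF fr', of i j], where l="real i" and m="real j" and r="-1" and t=1])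
         (use d in \<open>auto simp: algebra_simps det3_linear\<close>)
  qed
  show ?thesis
  proof (cases "n = 0")
    case True
    then show ?thesis using edge[OF fr, of l m] assms(3) by auto
  next
    case False
    have G: "A \<in> hpoints U" "B \<in> hpoints U" "C \<in> hpoints U"
      and pos: "0 < snd A" "0 < snd B" "0 < snd C" and "det3 A B C \<noteq> 0"
      using fr by (auto simp: inner_frame_def)
    note d = det3_nonzero_perm[OF \<open>det3 A B C \<noteq> 0\<close>]
    have A: "real l *\<^sub>R A + real n *\<^sub>R C \<in> hpoints U"
      using edge[OF inner_frame_perm(2)[OF fr], of l n] False by simp
    have B: "real m *\<^sub>R B + real n *\<^sub>R C \<in> hpoints U"
      using edge[OF inner_frame_perm(3)[OF fr], of m n] False by simp
    have s: "0 \<le> real l * snd A" "0 \<le> real m * snd B" "0 < real n * snd C" using pos False by auto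
    have "snd (real l *\<^sub>R A + real m *\<^sub>R B + real n *\<^sub>R C) \<noteq> 0"
      using s by (simp add: add_nonneg_pos less_imp_neq[THEN not_sym])
    then show ?thesis
      by (intro hpoints_meet[OF U A G(2) G(1) B, where l=1 and m="real m" and r="real l" and t=1])
         (use d False in \<open>auto simp: algebra_simps det3_linear\<close>)
  qed
qed

text \<open>
  A vector \<open>X\<close> with coefficients of arbitrary sign becomes positive after adding a large
  multiple of a positive vector \<open>D\<close>, so its point lies on the line through the triangle points
  of \<open>X + N D\<close> and \<open>D\<close>. Two choices of \<open>D\<close> for which \<open>X\<close> and the two choices are independent
  give two different lines. The choices are \<open>A + B + C\<close> and \<open>A + i B + j C\<close>; one of
  \<open>(i, j) = (2, 1)\<close> and \<open>(1, 2)\<close> works unless \<open>X\<close> is a multiple of \<open>A + B + C\<close>.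
\<close>

lemma inner_frame_int_combination:
  assumes U: "meet_closed U" and fr: "inner_frame U A B C"
    and nz: "snd (real_of_int x *\<^sub>R A + real_of_int y *\<^sub>R B + real_of_int z *\<^sub>R C) \<noteq> 0" (is "snd ?X \<noteq> 0")
  shows "real_of_int x *\<^sub>R A + real_of_int y *\<^sub>R B + real_of_int z *\<^sub>R C \<in> hpoints U"
proof -
  \<comment> \<open>N exceeds the absolute values of the coefficients, so that all shifted ones are positive.\<close>
  define N where "N = nat (\<bar>x\<bar> + \<bar>y\<bar> + \<bar>z\<bar> + 1)"
  have "det3 A B C \<noteq> 0" using fr by (simp add: inner_frame_def)
  note d = det3_nonzero_perm[OF this]
  have shift: "?X + real N *\<^sub>R (A + real i *\<^sub>R B + real j *\<^sub>R C) \<in> hpoints U"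
    if "i \<ge> 1" "j \<ge> 1" for i j
  proof -
    have N: "int N = \<bar>x\<bar> + \<bar>y\<bar> + \<bar>z\<bar> + 1" by (simp add: N_def)
    have "int N * int i \<ge> int N * 1" "int N * int j \<ge> int N * 1"
      using that by (intro mult_left_mono; simp)+
    with N have p: "x + int N > 0" "y + int N * int i > 0" "z + int N * int j > 0" by linarith+
    have e: "real (nat (x + int N)) = x + real N" "real (nat (y + int N * int i)) = y + real N * real i"
      "real (nat (z + int N * int j)) = z + real N * real j"
      using p by auto
    show ?thesis
      using inner_frame_nat_combination[OF U fr, of "nat (x + int N)" "nat (y + int N * int i)" "nat (z + int N * int j)"] p
      unfolding e by (simp add: algebra_simps)
  qed
  have pencil: "A + real i *\<^sub>R B + real j *\<^sub>R C \<in> hpoints U" for i j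
    using inner_frame_nat_combination[OF U fr, of 1 i j] by simp
  have two_lines: "?X \<in> hpoints U" if ij: "(y - x) * (int j - 1) \<noteq> (z - x) * (int i - 1)" "i \<ge> 1" "j \<ge> 1" for i j
  proof -
    have "det3 (?X + real N *\<^sub>R (A + real 1 *\<^sub>R B + real 1 *\<^sub>R C)) (A + real 1 *\<^sub>R B + real 1 *\<^sub>R C)
        (A + real i *\<^sub>R B + real j *\<^sub>R C)
      = of_int ((z - x) * (int i - 1) - (y - x) * (int j - 1)) * det3 A B C"
      by (simp add: det3_def algebra_simps)
    also have "\<dots> \<noteq> 0"
      using ij(1) d(1) by (simp del: of_int_diff of_int_mult)
    finally have i: "det3 (?X + real N *\<^sub>R (A + real 1 *\<^sub>R B + real 1 *\<^sub>R C)) (A + real 1 *\<^sub>R B + real 1 *\<^sub>R C)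
        (A + real i *\<^sub>R B + real j *\<^sub>R C) \<noteq> 0" .
    show ?thesis
      by (rule hpoints_meet[OF U shift[of 1 1] pencil[of 1 1] pencil[of i j] shift[of i j],
            where l=1 and m="- real N" and r="- real N" and t=1, OF _ _ _ _ _ _ i nz])
         (use ij in auto)
  qed
  consider "y \<noteq> x" | "z \<noteq> x" | "y = x" "z = x" by blast
  then show ?thesis
  proof cases
    case 1
    then show ?thesis using two_lines[of 2 1] by simp
  next
    case 2
    then show ?thesis using two_lines[of 1 2] by simp
  next
    case 3
    have X: "?X = real_of_int x *\<^sub>R (A + B + C)" using 3 by (simp add: algebra_simps)
    then have "x \<noteq> 0" using nz by auto
    then show ?thesis unfolding X using fr by (simp add: hpoints_scale inner_frame_def)
  qed
qed

lemma tendsto_floor_div: "(\<lambda>n. of_int \<lfloor>real n * x\<rfloor> / real n) \<longlonglongrightarrow> x"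
proof (rule tendsto_sandwich)
  show "\<forall>\<^sub>F n in sequentially. x - 1 / real n \<le> of_int \<lfloor>real n * x\<rfloor> / real n"
    using eventually_gt_at_top[of 0]
  proof eventually_elim
    case (elim n)
    have "real n * x - 1 \<le> of_int \<lfloor>real n * x\<rfloor>" by linarith
    then have "(real n * x - 1) / real n \<le> of_int \<lfloor>real n * x\<rfloor> / real n"
      by (intro divide_right_mono) auto
    then show ?case using elim by (simp add: diff_divide_distrib)
  qed
  show "\<forall>\<^sub>F n in sequentially. of_int \<lfloor>real n * x\<rfloor> / real n \<le> x"
    using eventually_gt_at_top[of 0]
    by eventually_elim (simp add: field_simps)
  show "(\<lambda>n. x - 1 / real n) \<longlonglongrightarrow> x"
    using tendsto_diff[OF tendsto_const lim_1_over_n, of x] by simp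
qed simp

text \<open>
  Rounding the coefficients of \<open>n\<close> times a representative of an arbitrary point to integers and
  dividing by \<open>n\<close> approximates the representative, hence the point.
\<close>

lemma inner_frame_dense:
  assumes U: "meet_closed U" and fr: "inner_frame U A B C"
  shows "closure U = UNIV"
proof -
  have "p \<in> closure U" for p
  proof -
    have d: "det3 A B C \<noteq> 0" using fr by (simp add: inner_frame_def)
    obtain x y z where p: "lift p = x *\<^sub>R A + y *\<^sub>R B + z *\<^sub>R C"
      using cramer[OF d] by blast
    define K where "K t n = real_of_int \<lfloor>real n * t\<rfloor>" for t n
    define X where "X n = K x n *\<^sub>R A + K y n *\<^sub>R B + K z n *\<^sub>R C" for n
    define Y where "Y n = (1 / real n) *\<^sub>R X n" for n
    have Y: "Y n = (K x n / real n) *\<^sub>R A + (K y n / real n) *\<^sub>R B + (K z n / real n) *\<^sub>R C" for n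
      by (simp add: X_def Y_def scaleR_add_right)
    have lim: "Y \<longlonglongrightarrow> lift p"
      unfolding p Y K_def by (intro tendsto_intros tendsto_floor_div)
    have lims: "(\<lambda>n. snd (Y n)) \<longlonglongrightarrow> 1"
      using tendsto_snd[OF lim] by simp
    have limp: "(\<lambda>n. fst (Y n) /\<^sub>R snd (Y n)) \<longlonglongrightarrow> p"
      using tendsto_scaleR[OF tendsto_inverse[OF lims] tendsto_fst[OF lim]] by simp
    have "\<forall>\<^sub>F n in sequentially. snd (Y n) > 0"
      using order_tendstoD(1)[OF lims, of 0] by simp
    then have "\<forall>\<^sub>F n in sequentially. fst (Y n) /\<^sub>R snd (Y n) \<in> U"
      using eventually_gt_at_top[of 0]
    proof eventually_elim
      case (elim n)
      then have "snd (X n) \<noteq> 0" by (auto simp: Y_def)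
      then have "X n \<in> hpoints U"
        using inner_frame_int_combination[OF U fr] by (simp add: X_def K_def)
      then have "Y n \<in> hpoints U" using elim by (simp add: Y_def hpoints_scale)
      then show ?case by (simp add: hpoints_def)
    qed
    then obtain M where "\<And>n. n \<ge> M \<Longrightarrow> fst (Y n) /\<^sub>R snd (Y n) \<in> U"
      unfolding eventually_sequentially by blast
    then show ?thesis
      unfolding closure_sequential
      using LIMSEQ_ignore_initial_segment[OF limp, of M]
      by (intro exI[of _ "\<lambda>n. fst (Y (n + M)) /\<^sub>R snd (Y (n + M))"]) auto
  qed
  then show ?thesis by blast
qed

section \<open>Quadrangles other than parallelograms\<close>

text \<open>
  A convex quadrangle whose diagonals \<open>A C\<close> and \<open>B D\<close> meet in \<open>A + C = B + D\<close>. Two opposite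
  sides meet in \<open>A - B = D - C\<close>, and \<open>A + C\<close> is the sum of the vertices of the triangle
  \<open>B\<close>, \<open>C\<close>, \<open>A - B\<close>. If \<open>A\<close> has greater weight than \<open>B\<close>, then the point \<open>A - B\<close> is finite and
  of positive weight. The other inequalities between weights reduce to this one by
  relabelling; equality of all weights is the parallelogram.
\<close>

lemma inner_quadrangle_dense:
  assumes U: "meet_closed U"
    and G: "A \<in> hpoints U" "B \<in> hpoints U" "C \<in> hpoints U" "D \<in> hpoints U"
    and pos: "0 < snd A" "0 < snd B" "0 < snd C" "0 < snd D"
    and sum: "A + C = B + D" and d: "det3 A B C \<noteq> 0" and ne: "snd A \<noteq> snd B \<or> snd A \<noteq> snd D"
  shows "closure U = UNIV"
proof -
  have main: "closure U = UNIV"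
    if G: "A \<in> hpoints U" "B \<in> hpoints U" "C \<in> hpoints U" "D \<in> hpoints U"
    and pos: "0 < snd A" "0 < snd B" "0 < snd C" "0 < snd D"
    and sum: "A + C = B + D" and "det3 A B C \<noteq> 0" and gt: "snd A > snd B" for A B C D
  proof -
    note d = det3_nonzero_perm[OF \<open>det3 A B C \<noteq> 0\<close>]
    have D: "D = A + C - B" using sum by (simp add: algebra_simps)
    have E: "A + C \<in> hpoints U"
      by (rule hpoints_meet[OF U G(1,3,2,4), where l=1 and m=1 and r=1 and t=1]) (use sum pos d in auto)
    have F: "A - B \<in> hpoints U"
      by (rule hpoints_meet[OF U G(1,2,4,3), where l=1 and m="-1" and r=1 and t="-1"])
         (use D gt d in \<open>auto simp: det3_linear\<close>)
    have "inner_frame U B C (A - B)"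
      unfolding inner_frame_def using E F G gt pos d by (auto simp: det3_linear algebra_simps)
    then show ?thesis by (rule inner_frame_dense[OF U])
  qed
  have D: "D = A + C - B" using sum by (simp add: algebra_simps)
  note d' = det3_nonzero_perm[OF d]
  have d2: "det3 B A D \<noteq> 0" "det3 A D C \<noteq> 0" "det3 D A B \<noteq> 0" using d' by (auto simp: D det3_linear)
  have s: "snd A + snd C = snd B + snd D" by (metis snd_add sum)
  consider "snd A > snd B" | "snd B > snd A" | "snd A > snd D" | "snd D > snd A"
    using ne by linarith
  then show ?thesis
  proof cases
    case 1 then show ?thesis using main[OF G pos sum d] by simp
  next
    case 2 then show ?thesis using main[OF G(2,1,4,3) pos(2,1,4,3) sum[symmetric] d2(1)] by simp
  next
    case 3 then show ?thesis using main[OF G(1,4,3,2) pos(1,4,3,2) _ d2(2)] sum by (simp add: add.commute)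
  next
    case 4 then show ?thesis using main[OF G(4,1,2,3) pos(4,1,2,3) _ d2(3)] sum by (simp add: add.commute)
  qed
qed

lemma interior_point_dense:
  assumes U: "meet_closed U" and mem: "a \<in> U" "b \<in> U" "c \<in> U" "d \<in> U"
    and d: "lift d = x *\<^sub>R lift a + y *\<^sub>R lift b + z *\<^sub>R lift c"
    and pos: "0 < x" "0 < y" "0 < z" and nc: "\<not> collinear {a, b, c}"
  shows "closure U = UNIV"
proof (rule inner_frame_dense[OF U])
  show "inner_frame U (x *\<^sub>R lift a) (y *\<^sub>R lift b) (z *\<^sub>R lift c)"
    unfolding inner_frame_def d[symmetric]
    using mem pos nc by (auto simp: hpoints_scale collinear_iff_det3 det3_linear)
qed

lemma convex_quadrangle_dense:
  assumes U: "meet_closed U" and mem: "a \<in> U" "b \<in> U" "c \<in> U" "d \<in> U"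
    and diag: "x *\<^sub>R lift a + z *\<^sub>R lift c = y *\<^sub>R lift b + w *\<^sub>R lift d"
    and pos: "0 < x" "0 < y" "0 < z" "0 < w" and nc: "\<not> collinear {a, b, c}"
    and np: "a + c \<noteq> b + d"
  shows "closure U = UNIV"
proof (rule inner_quadrangle_dense[OF U _ _ _ _ _ _ _ _ diag])
  have "x + z = y + w" using arg_cong[OF diag, of snd] by simp
  moreover have "x *\<^sub>R a + z *\<^sub>R c = y *\<^sub>R b + w *\<^sub>R d" using arg_cong[OF diag, of fst] by simp
  moreover have "a + c = b + d" if "x *\<^sub>R (a + c) = x *\<^sub>R (b + d)"
    using that pos by simp
  ultimately have "\<not> (x = y \<and> x = w)" using np by (auto simp: scaleR_add_right)
  then show "snd (x *\<^sub>R lift a) \<noteq> snd (y *\<^sub>R lift b) \<or> snd (x *\<^sub>R lift a) \<noteq> snd (w *\<^sub>R lift d)"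
    by simp
qed (use mem pos nc in \<open>auto simp: hpoints_scale collinear_iff_det3 det3_linear\<close>)

text \<open>
  The signs of the barycentric coordinates of \<open>d\<close> with respect to \<open>a\<close>, \<open>b\<close>, \<open>c\<close> decide the shape:
  with all signs positive, \<open>d\<close> is interior to the triangle; with one positive sign, that vertex
  is interior to the triangle of the others; with one negative sign, the quadrangle is convex
  and that vertex is opposite to \<open>d\<close>. The three excluded equations are the three ways
  in which four points can be the vertices of a parallelogram.
\<close>

lemma quadrangle_dense:
  assumes U: "meet_closed U" and mem: "a \<in> U" "b \<in> U" "c \<in> U" "d \<in> U"
    and nc: "\<not> collinear {a, b, c}" "\<not> collinear {d, b, c}" "\<not> collinear {a, d, c}" "\<not> collinear {a, b, d}"
    and np: "a + c \<noteq> b + d" "a + b \<noteq> c + d" "b + c \<noteq> a + d"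
  shows "closure U = UNIV"
proof -
  have abc: "det3 (lift a) (lift b) (lift c) \<noteq> 0" using nc by (simp add: collinear_iff_det3)
  obtain x y z where xyz: "lift d = x *\<^sub>R lift a + y *\<^sub>R lift b + z *\<^sub>R lift c"
    and nz: "x \<noteq> 0" "y \<noteq> 0" "z \<noteq> 0"
  proof (rule that[OF cramer[OF abc, of "lift d"]])
  qed (use nc in \<open>auto simp: collinear_iff_det3\<close>)
  have sum: "x + y + z = 1" using arg_cong[OF xyz, of snd] by simp
  have nc': "\<not> collinear {d, a, c}" "\<not> collinear {d, a, b}" "\<not> collinear {b, d, c}" "\<not> collinear {a, d, b}"
    using nc by (simp_all add: insert_commute)
  consider "x > 0" "y > 0" "z > 0"
    | "x > 0" "y < 0" "z < 0" | "x < 0" "y > 0" "z < 0" | "x < 0" "y < 0" "z > 0"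
    | "x < 0" "y > 0" "z > 0" | "x > 0" "y < 0" "z > 0" | "x > 0" "y > 0" "z < 0"
  proof -
    have "x < 0 \<or> x > 0" "y < 0 \<or> y > 0" "z < 0 \<or> z > 0" "\<not> (x < 0 \<and> y < 0 \<and> z < 0)"
      using nz sum by auto
    then show ?thesis using that by blast
  qed
  then show ?thesis
  proof cases
    case 1
    then show ?thesis using interior_point_dense[OF U mem xyz] nc by blast
  next
    case 2
    have "lift a = (1/x) *\<^sub>R lift d + (-y/x) *\<^sub>R lift b + (-z/x) *\<^sub>R lift c"
      using nz by (simp add: xyz scaleR_add_right)
    from interior_point_dense[OF U mem(4,2,3,1) this _ _ _ nc(2)] 2 show ?thesis
      by (simp add: divide_less_0_iff zero_less_divide_iff)
  next
    case 3
    have "lift b = (1/y) *\<^sub>R lift d + (-x/y) *\<^sub>R lift a + (-z/y) *\<^sub>R lift c"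
      using nz by (simp add: xyz scaleR_add_right)
    from interior_point_dense[OF U mem(4,1,3,2) this _ _ _ nc'(1)] 3 show ?thesis
      by (simp add: divide_less_0_iff zero_less_divide_iff)
  next
    case 4
    have "lift c = (1/z) *\<^sub>R lift d + (-x/z) *\<^sub>R lift a + (-y/z) *\<^sub>R lift b"
      using nz by (simp add: xyz scaleR_add_right)
    from interior_point_dense[OF U mem(4,1,2,3) this _ _ _ nc'(2)] 4 show ?thesis
      by (simp add: divide_less_0_iff zero_less_divide_iff)
  next
    case 5
    have "y *\<^sub>R lift b + z *\<^sub>R lift c = 1 *\<^sub>R lift d + (-x) *\<^sub>R lift a" by (simp add: xyz)
    from convex_quadrangle_dense[OF U mem(2,4,3,1) this _ _ _ _ nc'(3)] 5 np show ?thesis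
      by (simp add: add.commute)
  next
    case 6
    have "x *\<^sub>R lift a + z *\<^sub>R lift c = 1 *\<^sub>R lift d + (-y) *\<^sub>R lift b" by (simp add: xyz)
    from convex_quadrangle_dense[OF U mem(1,4,3,2) this _ _ _ _ nc(3)] 6 np show ?thesis
      by (simp add: add.commute)
  next
    case 7
    have "x *\<^sub>R lift a + y *\<^sub>R lift b = 1 *\<^sub>R lift d + (-z) *\<^sub>R lift c" by (simp add: xyz)
    from convex_quadrangle_dense[OF U mem(1,4,2,3) this _ _ _ _ nc'(4)] 7 np show ?thesis
      by (simp add: add.commute)
  qed
qed

section \<open>A parallelogram and a fifth point\<close>

text \<open>
  The point \<open>f\<close> lies on the ray from the midpoint \<open>o\<close> of \<open>a c\<close> through \<open>b\<close>, at \<open>o + t (b - o)\<close>. For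
  \<open>t < 1\<close> it is interior to the triangle \<open>a b c\<close>, and for \<open>t > 1\<close> the point \<open>b\<close> is interior to
  the triangle \<open>a f c\<close>.
\<close>

lemma median_point_dense:
  assumes U: "meet_closed U" and mem: "a \<in> U" "b \<in> U" "c \<in> U" "f \<in> U"
    and f: "lift f = ((1 - t) / 2) *\<^sub>R (lift a + lift c) + t *\<^sub>R lift b"
    and t: "0 < t" "t \<noteq> 1" and nc: "\<not> collinear {a, b, c}"
  shows "closure U = UNIV"
proof (cases "t < 1")
  case True
  then show ?thesis
    using interior_point_dense[OF U mem, of "(1 - t) / 2" t "(1 - t) / 2"] t nc f
    by (simp add: algebra_simps)
next
  case False
  have b: "lift b = (1 / t) *\<^sub>R lift f + ((t - 1) / (2 * t)) *\<^sub>R lift a + ((t - 1) / (2 * t)) *\<^sub>R lift c"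
    unfolding f using t by (simp add: scaleR_add_right add_divide_distrib diff_divide_distrib algebra_simps)
  have "\<not> collinear {f, a, c}"
    using nc t det3_nonzero_perm[of "lift a" "lift b" "lift c"]
    unfolding collinear_iff_det3 f by (auto simp: det3_linear)
  then show ?thesis
    using interior_point_dense[OF U mem(4,1,3,2) b] False t by simp
qed

lemma lift_midpoint: "lift (midpoint a c) = (1/2) *\<^sub>R (lift a + lift c)"
  by (simp add: midpoint_def prod_eq_iff)

text \<open>
  With the centre \<open>m\<close> of the parallelogram as origin, \<open>e\<close> is \<open>m + x (a - m) + y (b - m)\<close>. Projecting
  \<open>e\<close> from \<open>a\<close> to the diagonal \<open>b d\<close> gives \<open>m + t (b - m)\<close> with \<open>t = y / (1 - x)\<close>. The hypotheses
  on \<open>x\<close> and \<open>y\<close> say that this is a finite point other than \<open>m\<close>, \<open>b\<close> and \<open>d\<close>, so it lies on the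
  ray through \<open>b\<close> or on the ray through \<open>d\<close>.
\<close>

lemma parallelogram_project_dense:
  assumes U: "meet_closed U" and mem: "a \<in> U" "b \<in> U" "c \<in> U" "d \<in> U" "e \<in> U"
    and par: "a + c = b + d" and nc: "\<not> collinear {a, b, c}"
    and e: "lift e = ((1 - x - y) / 2) *\<^sub>R (lift a + lift c) + x *\<^sub>R lift a + y *\<^sub>R lift b"
    and xy: "y \<noteq> 0" "x \<noteq> 1" "\<bar>y\<bar> \<noteq> \<bar>1 - x\<bar>"
  shows "closure U = UNIV"
proof -
  have "det3 (lift a) (lift b) (lift c) \<noteq> 0" using nc by (simp add: collinear_iff_det3)
  note n = det3_nonzero_perm[OF this]
  define m where "m = midpoint a c"
  have ld: "lift d = lift a + lift c - lift b"
    using par by (simp add: prod_eq_iff algebra_simps)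
  have lo: "lift m = (1/2) *\<^sub>R lift a + (1/2) *\<^sub>R lift c"
    by (simp add: m_def lift_midpoint scaleR_add_right)
  have m: "lift a \<in> hpoints U" "lift b \<in> hpoints U" "lift c \<in> hpoints U" "lift d \<in> hpoints U" "lift e \<in> hpoints U"
    using mem by simp_all
  have lo2: "lift m = (1/2) *\<^sub>R lift b + (1/2) *\<^sub>R lift d"
    by (simp add: lo ld scaleR_add_right scaleR_diff_right)
  have O: "lift m \<in> hpoints U"
    by (rule hpoints_meet[OF U m(1,3,2,4) lo lo2]) (use n in auto)
  define t where "t = y / (1 - x)"
  define F where "F = (1 - x - y) *\<^sub>R lift m + y *\<^sub>R lift b"
  have F: "F = 1 *\<^sub>R lift e + (-x) *\<^sub>R lift a"
    by (simp add: F_def e lo algebra_simps)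
  have "F \<in> hpoints U"
    by (rule hpoints_meet[OF U m(5,1) O m(2) F F_def])
       (use n xy in \<open>auto simp: F e lo det3_linear field_simps\<close>)
  then obtain k f where k: "k \<noteq> 0" and f: "f \<in> U" "F = k *\<^sub>R lift f" by (rule hpointsE)
  have "k = snd F" using f by simp
  also have "\<dots> = 1 - x" by (simp add: F)
  finally have "k = 1 - x" .
  have "lift f = (1/k) *\<^sub>R F" using k f by simp
  also have "\<dots> = ((1 - t) / 2) *\<^sub>R (lift a + lift c) + t *\<^sub>R lift b"
  proof -
    have "(1 - x - y) / (1 - x) = 1 - t" using xy by (simp add: t_def diff_divide_distrib)
    then show ?thesis unfolding F_def lo \<open>k = 1 - x\<close> scaleR_add_right scaleR_scaleR by (simp add: t_def)
  qed
  finally have f1: "lift f = ((1 - t) / 2) *\<^sub>R (lift a + lift c) + t *\<^sub>R lift b" .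
  then have f2: "lift f = ((1 - (-t)) / 2) *\<^sub>R (lift a + lift c) + (-t) *\<^sub>R lift d"
    by (simp add: ld prod_eq_iff vec_eq_iff forall_2 field_simps)
  have ty: "y = t * (1 - x)" using xy by (simp add: t_def)
  have "t \<noteq> 0" "t \<noteq> 1" using ty xy by auto
  have "-t \<noteq> 1"
  proof
    assume "-t = 1"
    then have "t = -1" by simp
    then show False using ty xy(3) by (simp add: abs_minus_commute)
  qed
  have "\<not> collinear {a, d, c}" using n by (auto simp: ld collinear_iff_det3 det3_linear)
  show ?thesis
  proof (cases "t > 0")
    case True
    then show ?thesis using median_point_dense[OF U mem(1-3) f(1) f1 _ \<open>t \<noteq> 1\<close> nc] by blast
  next
    case False
    then show ?thesis using median_point_dense[OF U mem(1,4,3) f(1) f2 _ \<open>- t \<noteq> 1\<close> \<open>\<not> collinear {a, d, c}\<close>] \<open>t \<noteq> 0\<close> by linarith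
  qed
qed

text \<open>
  At least one of the four projections of \<open>e\<close> from a vertex to the diagonal not containing that
  vertex gives a new point. On the lines of the diagonals this is immediate. Otherwise
  projecting from \<open>a\<close> and from \<open>c\<close> gives the parameters \<open>y / (1 - x)\<close> and \<open>y / (1 + x)\<close>, which
  cannot both be \<open>1\<close> or \<open>-1\<close> since \<open>x \<noteq> 0\<close>; the cases \<open>x = 1\<close> and \<open>x = -1\<close>, in which one
  projection is lost at infinity, are settled with the help of \<open>b\<close> and \<open>d\<close>.
\<close>

lemma parallelogram_extra_dense:
  assumes U: "meet_closed U" and mem: "a \<in> U" "b \<in> U" "c \<in> U" "d \<in> U" "e \<in> U"
    and par: "a + c = b + d" and nc: "\<not> collinear {a, b, c}"
    and e: "e \<notin> {a, b, c, d, midpoint a c}"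
  shows "closure U = UNIV"
proof -
  have abc: "det3 (lift a) (lift b) (lift c) \<noteq> 0" using nc by (simp add: collinear_iff_det3)
  note n = det3_nonzero_perm[OF abc]
  have ld: "lift d = lift a + lift c - lift b"
    using par by (simp add: prod_eq_iff algebra_simps)
  obtain x' y z' where e': "lift e = x' *\<^sub>R lift a + y *\<^sub>R lift b + z' *\<^sub>R lift c"
    using cramer[OF abc] by blast
  have sum: "x' + y + z' = 1" using arg_cong[OF e', of snd] by simp
  define x where "x = x' - z'"
  \<comment> \<open>With the centre as origin, e has coordinates x and y; e1 to e4 prepare the projections from a, c, b and d.\<close>
  have xz: "x' = (1 + x - y) / 2" "z' = (1 - x - y) / 2" using sum by (simp_all add: x_def field_simps)
  have e1: "lift e = ((1 - x - y) / 2) *\<^sub>R (lift a + lift c) + x *\<^sub>R lift a + y *\<^sub>R lift b"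
    unfolding e' xz by (simp add: prod_eq_iff vec_eq_iff forall_2 field_simps)
  have e2: "lift e = ((1 - (-x) - y) / 2) *\<^sub>R (lift c + lift a) + (-x) *\<^sub>R lift c + y *\<^sub>R lift b"
    unfolding e' xz by (simp add: prod_eq_iff vec_eq_iff forall_2 field_simps)
  have e3: "lift e = ((1 - y - x) / 2) *\<^sub>R (lift b + lift d) + y *\<^sub>R lift b + x *\<^sub>R lift a"
    unfolding e' xz ld by (simp add: prod_eq_iff vec_eq_iff forall_2 field_simps)
  have e4: "lift e = ((1 - (-y) - x) / 2) *\<^sub>R (lift d + lift b) + (-y) *\<^sub>R lift d + x *\<^sub>R lift a"
    unfolding e' xz ld by (simp add: prod_eq_iff vec_eq_iff forall_2 field_simps)
  have nc': "\<not> collinear {c, b, a}" "\<not> collinear {b, a, d}" "\<not> collinear {d, a, b}"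
    using n by (auto simp: ld collinear_iff_det3 det3_linear)
  have inj: "p = q" if "lift p = lift q" for p q using that by (simp add: lift_def)
  have "\<not> (x = 0 \<and> y = 0)" "\<not> (x = 1 \<and> y = 0)" "\<not> (x = -1 \<and> y = 0)" "\<not> (x = 0 \<and> y = 1)" "\<not> (x = 0 \<and> y = -1)"
    using e1 e inj[of e "midpoint a c"] inj[of e a] inj[of e b] inj[of e c] inj[of e d]
    by (auto simp: lift_midpoint ld algebra_simps)
  then have "(y \<noteq> 0 \<and> x \<noteq> 1 \<and> \<bar>y\<bar> \<noteq> \<bar>1 - x\<bar>) \<or> (y \<noteq> 0 \<and> -x \<noteq> 1 \<and> \<bar>y\<bar> \<noteq> \<bar>1 - (-x)\<bar>)
    \<or> (x \<noteq> 0 \<and> y \<noteq> 1 \<and> \<bar>x\<bar> \<noteq> \<bar>1 - y\<bar>) \<or> (x \<noteq> 0 \<and> -y \<noteq> 1 \<and> \<bar>x\<bar> \<noteq> \<bar>1 - (-y)\<bar>)"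
  proof -
    consider "x = 0" | "y = 0" | "x = 1" "y \<noteq> 0" | "x = -1" "y \<noteq> 0" | "x \<noteq> 0" "x \<noteq> 1" "x \<noteq> -1" "y \<noteq> 0"
      by blast
    then show ?thesis
    proof cases
      case 5
      then have "\<bar>1 - x\<bar> \<noteq> \<bar>1 - (-x)\<bar>" by (simp add: abs_if)
      then show ?thesis using 5 by auto
    qed (use \<open>\<not> (x = 0 \<and> y = 0)\<close> \<open>\<not> (x = 1 \<and> y = 0)\<close> \<open>\<not> (x = -1 \<and> y = 0)\<close>
           \<open>\<not> (x = 0 \<and> y = 1)\<close> \<open>\<not> (x = 0 \<and> y = -1)\<close> in \<open>auto simp: abs_if split: if_splits\<close>)
  qed
  then consider "y \<noteq> 0" "x \<noteq> 1" "\<bar>y\<bar> \<noteq> \<bar>1 - x\<bar>" | "y \<noteq> 0" "-x \<noteq> 1" "\<bar>y\<bar> \<noteq> \<bar>1 - (-x)\<bar>"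
    | "x \<noteq> 0" "y \<noteq> 1" "\<bar>x\<bar> \<noteq> \<bar>1 - y\<bar>" | "x \<noteq> 0" "-y \<noteq> 1" "\<bar>x\<bar> \<noteq> \<bar>1 - (-y)\<bar>"
    by blast
  then show ?thesis
  proof cases
    case 1 then show ?thesis by (rule parallelogram_project_dense[OF U mem par nc e1])
  next
    case 2 then show ?thesis using parallelogram_project_dense[OF U mem(3,2,1,4,5) _ nc'(1) e2] par by (simp add: add.commute)
  next
    case 3 then show ?thesis using parallelogram_project_dense[OF U mem(2,1,4,3,5) _ nc'(2) e3] par by simp
  next
    case 4 then show ?thesis using parallelogram_project_dense[OF U mem(4,1,2,3,5) _ nc'(3) e4] par by (simp add: add.commute)
  qed
qed

section \<open>The iterates\<close>

lemma connecting_lines_mono: "A \<subseteq> B \<Longrightarrow> connecting_lines A \<subseteq> connecting_lines B"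
  unfolding connecting_lines_def by blast

lemma line_intersections_mono: "A \<subseteq> B \<Longrightarrow> line_intersections A \<subseteq> line_intersections B"
  unfolding line_intersections_def using connecting_lines_mono[of A B] by blast

lemma noncollinear_triple_through:
  assumes "\<not> collinear S" "p \<in> S"
  obtains q r where "q \<in> S" "r \<in> S" "\<not> collinear {p, q, r}"
proof -
  have "\<not> S \<subseteq> {p}" using assms(1) collinear_subset[OF collinear_sing, of S p] by blast
  then obtain q where q: "q \<in> S" "q \<noteq> p" by blast
  have "insert p (insert q S) = S" using assms q by blast
  then have "\<not> (\<forall>r\<in>S. collinear {p, q, r})"
    using collinear_triples[of p q S] q assms by auto
  then show ?thesis using that q by blast
qed

text \<open>
  A point \<open>p\<close> of a non-collinear set is the vertex of a triangle in the set, hence the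
  intersection of two of its sides.
\<close>

lemma subset_line_intersections:
  assumes "\<not> collinear S"
  shows "S \<subseteq> line_intersections S"
proof
  fix p assume "p \<in> S"
  then obtain q r where qr: "q \<in> S" "r \<in> S" "\<not> collinear {p, q, r}"
    using noncollinear_triple_through assms by blast
  then have ne: "p \<noteq> q" "p \<noteq> r" by (auto simp: insert_commute)
  have "affine hull {p, q} \<noteq> affine hull {p, r}"
    using qr(3) ne(1) collinear_3_affine_hull[of p q r] hull_inc[of r "{p, r}" affine] by auto
  moreover have "p \<in> affine hull {p, q} \<inter> affine hull {p, r}" by (simp add: hull_inc)
  ultimately show "p \<in> line_intersections S"
    unfolding line_intersections_def connecting_lines_def using ne qr \<open>p \<in> S\<close> by blast
qed

text \<open>
  As the iterates increase, four points of the union lie in a common iterate.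
\<close>

lemma meet_closed_iterates:
  assumes "\<not> collinear S"
  shows "meet_closed (\<Union>i. (line_intersections ^^ i) S)"
proof -
  define T where "T i = (line_intersections ^^ i) S" for i
  have nc: "\<not> collinear (T i)" for i
  proof (induction i)
    case 0
    then show ?case using assms by (simp add: T_def)
  next
    case (Suc i)
    then show ?case
      using subset_line_intersections[OF Suc] collinear_subset by (auto simp: T_def)
  qed
  have "T i \<subseteq> T (Suc i)" for i
    using subset_line_intersections[OF nc[of i]] by (simp add: T_def)
  then have mono: "T i \<subseteq> T j" if "i \<le> j" for i j
    using that by (rule lift_Suc_mono_le)
  have "line_intersections (\<Union>i. T i) \<subseteq> (\<Union>i. T i)"
  proof
    fix x assume "x \<in> line_intersections (\<Union>i. T i)"
    then obtain p q r s where *: "p \<in> (\<Union>i. T i)" "q \<in> (\<Union>i. T i)" "p \<noteq> q" "r \<in> (\<Union>i. T i)" "s \<in> (\<Union>i. T i)" "r \<noteq> s"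
      "affine hull {p, q} \<noteq> affine hull {r, s}" "x \<in> affine hull {p, q}" "x \<in> affine hull {r, s}"
      unfolding line_intersections_def connecting_lines_def by blast
    then obtain i j k l where "p \<in> T i" "q \<in> T j" "r \<in> T k" "s \<in> T l" by blast
    then have "p \<in> T (i + j + k + l)" "q \<in> T (i + j + k + l)" "r \<in> T (i + j + k + l)" "s \<in> T (i + j + k + l)"
      by (meson mono le_add1 le_add2 le_trans subsetD)+
    then have "x \<in> line_intersections (T (i + j + k + l))"
      unfolding line_intersections_def connecting_lines_def using * by blast
    then have "x \<in> T (Suc (i + j + k + l))" by (simp add: T_def)
    then show "x \<in> (\<Union>i. T i)" by blast
  qed
  then show ?thesis by (simp add: meet_closed_def T_def)
qed

section \<open>The exceptional configurations\<close>

lemma iterates_subset: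
  assumes "S \<subseteq> E" "line_intersections E \<subseteq> E"
  shows "(\<Union>i. (line_intersections ^^ i) S) \<subseteq> E"
proof -
  have "(line_intersections ^^ i) S \<subseteq> E" for i
    by (induction i) (use assms line_intersections_mono in \<open>auto, blast\<close>)
  then show ?thesis by blast
qed

lemma iterates_not_dense:
  assumes "S \<subseteq> E" "line_intersections E \<subseteq> E" "finite E"
  shows "closure (\<Union>i. (line_intersections ^^ i) S) \<noteq> UNIV"
proof
  assume "closure (\<Union>i. (line_intersections ^^ i) S) = UNIV"
  moreover have "closure (\<Union>i. (line_intersections ^^ i) S) \<subseteq> E"
    using closure_minimal[OF iterates_subset[OF assms(1,2)] finite_imp_closed[OF assms(3)]] .
  ultimately have "finite (UNIV :: (real^2) set)" using assms(3) finite_subset by auto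
  then show False using infinite_UNIV_char_0 by (metis infinite_UNIV_vec)
qed

lemma affine_hull_two_points:
  assumes "x \<in> affine hull {p, q}" "y \<in> affine hull {p, q}" "x \<noteq> y"
  shows "affine hull {p, q} = affine hull {x, y}"
proof
  show "affine hull {x, y} \<subseteq> affine hull {p, q}"
    using assms by (intro hull_minimal) auto
  have "z \<in> affine hull {x, y}" if "z \<in> affine hull {p, q}" for z
    unfolding collinear_3_affine_hull[OF assms(3), symmetric] collinear_affine_hull
    using assms that by blast
  then show "affine hull {p, q} \<subseteq> affine hull {x, y}" by blast
qed

lemma connecting_lines_meet_once:
  assumes "L \<in> connecting_lines S" "M \<in> connecting_lines S" "L \<noteq> M" "x \<in> L \<inter> M" "y \<in> L \<inter> M"
  shows "x = y"
proof (rule ccontr)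
  assume "x \<noteq> y"
  have "N = affine hull {x, y}" if "N \<in> connecting_lines S" "x \<in> N" "y \<in> N" for N
  proof -
    obtain p q where "N = affine hull {p, q}" using \<open>N \<in> connecting_lines S\<close> unfolding connecting_lines_def by blast
    then show ?thesis using affine_hull_two_points that \<open>x \<noteq> y\<close> by simp
  qed
  then show False using assms by blast
qed

text \<open>
  Since two distinct lines share at most one point, it suffices to exhibit some point of \<open>E\<close> on
  any two distinct connecting lines that meet.
\<close>

lemma line_intersections_subsetI:
  assumes "\<And>L M x. L \<in> connecting_lines E \<Longrightarrow> M \<in> connecting_lines E \<Longrightarrow> L \<noteq> M \<Longrightarrow> x \<in> L \<Longrightarrow> x \<in> M \<Longrightarrow> \<exists>s\<in>E. s \<in> L \<inter> M"
  shows "line_intersections E \<subseteq> E"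
proof
  fix x assume "x \<in> line_intersections E"
  then obtain L M where LM: "L \<in> connecting_lines E" "M \<in> connecting_lines E" "L \<noteq> M" "x \<in> L" "x \<in> M"
    unfolding line_intersections_def by blast
  then obtain s where "s \<in> E" "s \<in> L \<inter> M" using assms by blast
  then show "x \<in> E" using connecting_lines_meet_once[OF LM(1-3), of x s] LM by simp
qed

lemma line_through_collinear:
  assumes "collinear A" "q \<in> A" "r \<in> A" "q \<noteq> r"
  shows "A \<subseteq> affine hull {q, r}"
proof
  fix z assume "z \<in> A"
  then have "collinear {q, r, z}" using assms collinear_subset[of A "{q, r, z}"] by blast
  then show "z \<in> affine hull {q, r}" using assms collinear_3_affine_hull by blast
qed

text \<open>
  Apart from the line containing \<open>A\<close>, all connecting lines join \<open>p\<close> to points of \<open>A\<close>.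
\<close>

lemma pencil_line_intersections:
  assumes A: "collinear A"
  shows "line_intersections (insert p A) \<subseteq> insert p A"
proof (rule line_intersections_subsetI)
  have *: "(p \<in> L \<and> (\<exists>a\<in>A. a \<in> L)) \<or> (A \<subseteq> L \<and> (\<exists>q\<in>A. \<exists>r\<in>A. q \<noteq> r \<and> L = affine hull {q, r}))"
    if "L \<in> connecting_lines (insert p A)" for L
  proof -
    from that obtain q r where qr: "q \<in> insert p A" "r \<in> insert p A" "q \<noteq> r" "L = affine hull {q, r}"
      unfolding connecting_lines_def by blast
    have "q \<in> L" "r \<in> L" using qr by (auto simp: hull_inc)
    then show ?thesis using qr line_through_collinear[OF A, of q r] by blast
  qed
  fix L M x
  assume L: "L \<in> connecting_lines (insert p A)" and M: "M \<in> connecting_lines (insert p A)" and "L \<noteq> M"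
  have False if "A \<subseteq> L" "A \<subseteq> M" "q \<in> A" "r \<in> A" "q \<noteq> r" for q r
    using connecting_lines_meet_once[OF L M \<open>L \<noteq> M\<close>, of q r] that by blast
  then show "\<exists>s\<in>insert p A. s \<in> L \<inter> M" using *[OF L] *[OF M] by blast
qed

text \<open>
  From left to right, parallelism of the sides gives \<open>d - c = k (b - a)\<close> and \<open>d - a = m (c - b)\<close>,
  and comparing the determinants with \<open>a\<close> and \<open>b\<close> forces \<open>m = 1\<close>.
\<close>

lemma parallelogram_iff:
  "parallelogram a b c d \<longleftrightarrow> \<not> collinear {a, b, c} \<and> a + c = b + d"
proof
  assume p: "\<not> collinear {a, b, c} \<and> a + c = b + d"
  then have d: "d = a + c - b" by (simp add: algebra_simps)
  have "affine hull {c, d} = (\<lambda>x. (c - b) + x) ` (affine hull {a, b})"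
    unfolding affine_hull_translation[symmetric] by (simp add: d insert_commute algebra_simps)
  moreover have "affine hull {a, d} = (\<lambda>x. (a - b) + x) ` (affine hull {b, c})"
    unfolding affine_hull_translation[symmetric] by (simp add: d insert_commute algebra_simps)
  ultimately show "parallelogram a b c d"
    using p unfolding parallelogram_def affine_parallel_def by blast
next
  assume p: "parallelogram a b c d"
  have dir: "\<exists>k. lift s - lift r = k *\<^sub>R (lift q - lift p)"
    if par: "affine_parallel (affine hull {p, q}) (affine hull {r, s})" for p q r s :: "real^2"
  proof -
    obtain v where v: "affine hull {r, s} = (\<lambda>x. v + x) ` (affine hull {p, q})"
      using par unfolding affine_parallel_def by blast
    have "r \<in> affine hull {r, s}" "s \<in> affine hull {r, s}" by (auto simp: hull_inc)
    then obtain i j where ij: "r = v + i" "i \<in> affine hull {p, q}" "s = v + j" "j \<in> affine hull {p, q}"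
      unfolding v by blast
    then obtain u1 v1 u2 v2 where uv: "i = u1 *\<^sub>R p + v1 *\<^sub>R q" "u1 + v1 = 1" "j = u2 *\<^sub>R p + v2 *\<^sub>R q" "u2 + v2 = 1"
      unfolding affine_hull_2 by blast
    have u: "u1 = 1 - v1" "u2 = 1 - v2" using uv by simp_all
    have "lift s - lift r = (v2 - v1) *\<^sub>R (lift q - lift p)"
      by (simp add: lift_def ij uv u algebra_simps)
    then show ?thesis by blast
  qed
  have nc: "\<not> collinear {a, b, c}" using p by (simp add: parallelogram_def)
  then have d: "det3 (lift a) (lift b) (lift c) \<noteq> 0" by (simp add: collinear_iff_det3)
  obtain k where k: "lift d - lift c = k *\<^sub>R (lift b - lift a)" using p dir unfolding parallelogram_def by blast
  obtain m where m: "lift d - lift a = m *\<^sub>R (lift c - lift b)" using p dir unfolding parallelogram_def by blast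
  have "det3 (lift a) (lift b) (lift d - lift c) = 0" unfolding k by (simp add: det3_linear)
  moreover have "det3 (lift a) (lift b) (lift d - lift a) = m * det3 (lift a) (lift b) (lift c)"
    unfolding m by (simp add: det3_linear)
  ultimately have "m = 1" using d by (simp add: det3_linear)
  then have "d - a = c - b" using arg_cong[OF m, of fst] by simp
  then show "\<not> collinear {a, b, c} \<and> a + c = b + d" using nc by (simp add: algebra_simps)
qed

lemma closed_segment_subset_affine_hull: "closed_segment p q \<subseteq> affine hull {p, q}"
  by (simp add: segment_convex_hull convex_hull_subset_affine_hull)

lemma midpoint_in_affine_hull: "midpoint p q \<in> affine hull {p, q}"
  using closed_segment_subset_affine_hull midpoint_in_closed_segment by blast

lemma diagonals_meet_in_midpoint:
  fixes a b c d :: "real^2"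
  assumes nc: "\<not> collinear {a, b, c}" and par: "a + c = b + d"
  shows "closed_segment a c \<inter> closed_segment b d = {midpoint a c}"
proof -
  have m: "midpoint a c = midpoint b d" using par by (simp add: midpoint_def)
  have ac: "a \<noteq> c" using nc by (auto simp: insert_commute)
  have "x = midpoint a c" if x: "x \<in> closed_segment a c" "x \<in> closed_segment b d" for x
  proof (rule ccontr)
    assume ne: "x \<noteq> midpoint a c"
    have "affine hull {a, c} = affine hull {x, midpoint a c}"
      using x(1) closed_segment_subset_affine_hull midpoint_in_affine_hull ne
      by (intro affine_hull_two_points) blast+
    also have "\<dots> = affine hull {b, d}"
      using x(2) closed_segment_subset_affine_hull midpoint_in_affine_hull[of b d] ne unfolding m
      by (intro affine_hull_two_points[symmetric]) blast+
    finally have "b \<in> affine hull {a, c}" by (simp add: hull_inc)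
    then show False using nc ac collinear_3_affine_hull[of a c b] by (simp add: insert_commute)
  qed
  moreover have "midpoint a c \<in> closed_segment a c" "midpoint a c \<in> closed_segment b d"
    using midpoint_in_closed_segment[of a c] midpoint_in_closed_segment[of b d] m by simp_all
  ultimately show ?thesis by blast
qed

lemma parallel_sides_disjoint:
  fixes a b c d :: "real^2"
  assumes nc: "\<not> collinear {a, b, c}" and par: "a + c = b + d"
  shows "affine hull {a, b} \<inter> affine hull {c, d} = {}"
proof -
  have ld: "lift d = lift a + lift c - lift b" using par by (simp add: prod_eq_iff algebra_simps)
  have False if x: "x \<in> affine hull {a, b}" "x \<in> affine hull {c, d}" for x
  proof -
    obtain u v where uv: "lift x = u *\<^sub>R lift a + v *\<^sub>R lift b" using x(1) unfolding lift_affine_hull by blast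
    obtain s t where st: "lift x = s *\<^sub>R lift c + t *\<^sub>R lift d" using x(2) unfolding lift_affine_hull by blast
    have "s + t = 1" using arg_cong[OF st, of snd] by simp
    have "0 = det3 (lift a) (lift b) (lift x)" by (simp add: uv det3_linear)
    also have "\<dots> = (s + t) * det3 (lift a) (lift b) (lift c)" by (simp add: st ld det3_linear algebra_simps)
    finally show False using nc \<open>s + t = 1\<close> by (simp add: collinear_iff_det3)
  qed
  then show ?thesis by blast
qed

text \<open>
  The five points span only six lines, four sides and two diagonals. Opposite sides are
  disjoint, and any other two of the lines have a vertex or the centre in common.
\<close>

lemma parallelogram_line_intersections:
  fixes a b c d :: "real^2"
  assumes nc: "\<not> collinear {a, b, c}" and par: "a + c = b + d"
  shows "line_intersections {a, b, c, d, midpoint a c} \<subseteq> {a, b, c, d, midpoint a c}" (is "line_intersections ?E \<subseteq> ?E")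
proof (rule line_intersections_subsetI)
  define m where "m = midpoint a c"
  let ?lines = "{affine hull {a, b}, affine hull {b, c}, affine hull {c, d}, affine hull {a, d},
    affine hull {a, c}, affine hull {b, d}}"
  have m': "m = midpoint b d" using par by (simp add: m_def midpoint_def)
  have ac: "a \<noteq> c" using nc by (auto simp: insert_commute)
  have bd: "b \<noteq> d"
  proof
    assume "b = d"
    then have "midpoint a c = b" using m' by (simp add: m_def)
    then show False using nc collinear_midpoint[of a c] by (simp add: insert_commute)
  qed
  have mem: "m \<in> affine hull {a, c}" "m \<in> affine hull {b, d}"
    using midpoint_in_affine_hull[of a c] midpoint_in_affine_hull[of b d]
    by (simp_all add: m'[symmetric] m_def[symmetric])
  have ne: "m \<noteq> a" "m \<noteq> c" "m \<noteq> b" "m \<noteq> d"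
    using ac bd by (simp_all add: m_def midpoint_eq_endpoint) (simp_all add: m_def[symmetric] m' midpoint_eq_endpoint)
  have half: "affine hull {a, m} = affine hull {a, c}" "affine hull {c, m} = affine hull {a, c}"
    "affine hull {b, m} = affine hull {b, d}" "affine hull {d, m} = affine hull {b, d}"
    using affine_hull_two_points[of _ a c m] affine_hull_two_points[of _ b d m] mem ne
    by (metis hull_inc insertI1 insertI2)+
  have lines: "L \<in> ?lines" if "L \<in> connecting_lines {a, b, c, d, m}" for L
  proof -
    from that obtain p q where "p \<in> {a, b, c, d, m}" "q \<in> {a, b, c, d, m}" "p \<noteq> q" "L = affine hull {p, q}"
      unfolding connecting_lines_def by blast
    moreover have "affine hull {q, p} = affine hull {p, q}" for p q :: "real^2"
      by (simp add: insert_commute)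
    note swap = this[of a b] this[of b c] this[of c d] this[of a d] this[of a c] this[of b d]
      this[of a m] this[of b m] this[of c m] this[of d m]
    ultimately show ?thesis
      by (elim insertE emptyE) (simp_all add: half swap)
  qed
  have "\<not> collinear {b, c, d}"
  proof -
    have "lift d = lift a + lift c - lift b" using par by (simp add: prod_eq_iff algebra_simps)
    then show ?thesis using nc det3_nonzero_perm[of "lift a" "lift b" "lift c"]
      by (auto simp: collinear_iff_det3 det3_linear)
  qed
  from parallel_sides_disjoint[OF nc par] parallel_sides_disjoint[OF this, of a]
  have disj: "affine hull {a, b} \<inter> affine hull {c, d} = {}" "affine hull {b, c} \<inter> affine hull {a, d} = {}"
    using par by (simp_all add: insert_commute add.commute)
  fix L M x
  assume "L \<in> connecting_lines ?E" "M \<in> connecting_lines ?E" and LM: "L \<noteq> M" "x \<in> L" "x \<in> M"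
  then have "L \<in> ?lines" "M \<in> ?lines" using lines by (simp_all add: m_def)
  then show "\<exists>s\<in>?E. s \<in> L \<inter> M"
    unfolding m_def[symmetric]
    using LM mem disj by (elim insertE emptyE) (auto simp: hull_inc)
qed

section \<open>Dense configurations\<close>

text \<open>
  If no three points of \<open>S\<close> are collinear, any four points will do, and there are four as a
  triangle is a line plus one point. Otherwise take three points on a line and two points \<open>x\<close>,
  \<open>y\<close> of \<open>S\<close> off it: the line \<open>x y\<close> passes through at most one of the three points, and the
  other two complete \<open>x\<close>, \<open>y\<close> to a quadrangle.
\<close>

lemma quadrangle_or_pencil:
  fixes S :: "(real^2) set"
  assumes nc: "\<not> collinear S"
    and np: "\<And>A p. collinear A \<Longrightarrow> \<not> collinear (insert p A) \<Longrightarrow> S \<noteq> insert p A"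
  obtains a b c d where "a \<in> S" "b \<in> S" "c \<in> S" "d \<in> S"
    "\<not> collinear {a, b, c}" "\<not> collinear {d, b, c}" "\<not> collinear {a, d, c}" "\<not> collinear {a, b, d}"
proof -
  note quadrangle = that
  show ?thesis
  proof (cases "\<exists>p\<in>S. \<exists>q\<in>S. \<exists>r\<in>S. p \<noteq> q \<and> p \<noteq> r \<and> q \<noteq> r \<and> collinear {p, q, r}")
    case True
    then obtain p q r where pqr: "p \<in> S" "q \<in> S" "r \<in> S" "p \<noteq> q" "p \<noteq> r" "q \<noteq> r" "collinear {p, q, r}" by blast
    define A where "A = S \<inter> affine hull {p, q}"
    have A: "collinear A" unfolding A_def collinear_affine_hull by blast
    have pA: "p \<in> A" "q \<in> A" "r \<in> A" using pqr collinear_3_affine_hull[of p q r] by (auto simp: A_def hull_inc)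
    have "\<not> S \<subseteq> A" using nc A collinear_subset by blast
    then obtain x where x: "x \<in> S" "x \<notin> A" by blast
    have "\<not> S \<subseteq> insert x A" using np[OF A, of x] nc x by (metis A_def Int_subset_iff insert_subset inf_le1 subset_antisym)
    then obtain y where y: "y \<in> S" "y \<notin> A" "y \<noteq> x" by blast
    have off: "\<not> collinear {i, j, z}" if "i \<in> A" "j \<in> A" "i \<noteq> j" "z \<in> S" "z \<notin> A" for i j z
    proof -
      have "affine hull {p, q} = affine hull {i, j}"
        using that by (intro affine_hull_two_points) (auto simp: A_def)
      then show ?thesis using that collinear_3_affine_hull[of i j z] by (auto simp: A_def)
    qed
    \<comment> \<open>The line joining x and y contains at most one point of A.\<close>
    have one: "\<not> collinear {x, y, i} \<or> \<not> collinear {x, y, j}" if "i \<in> A" "j \<in> A" "i \<noteq> j" for i j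
    proof (rule ccontr)
      assume "\<not> ?thesis"
      then have "collinear {i, x, y}" "collinear {x, y, j}" by (auto simp: insert_commute)
      then have "collinear {i, x, j}" using collinear_3_trans y(3) by blast
      then show False using off[OF that x] by (simp add: insert_commute)
    qed
    have fin: ?thesis if "i \<in> A" "j \<in> A" "i \<noteq> j" "\<not> collinear {x, y, i}" "\<not> collinear {x, y, j}" for i j
      using that off[OF that(1-3) x] off[OF that(1-3) y(1,2)] x y
      by (intro quadrangle[of i j x y]) (auto simp: A_def insert_commute)
    show ?thesis using one[of p q] one[of p r] one[of q r] fin[of p q] fin[of p r] fin[of q r] pA pqr(4-6) by blast
  next
    case False
    obtain a where "a \<in> S" using nc by fastforce
    then obtain b c where abc: "a \<in> S" "b \<in> S" "c \<in> S" "\<not> collinear {a, b, c}"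
      using noncollinear_triple_through[OF nc] by metis
    then have ne: "a \<noteq> b" "a \<noteq> c" "b \<noteq> c" by (auto simp: insert_commute)
    have "S \<noteq> insert c {a, b}" using np[of "{a, b}" c] abc by (simp add: insert_commute)
    then obtain d where "d \<in> S" "d \<noteq> a" "d \<noteq> b" "d \<noteq> c" using abc by blast
    then show ?thesis using abc ne False by (intro quadrangle[of a b c d]) metis+
  qed
qed

lemma parallelogram_superset_dense:
  assumes U: "meet_closed U" and S: "S \<subseteq> U" and mem: "a \<in> S" "b \<in> S" "c \<in> S" "d \<in> S"
    and nc: "\<not> collinear {a, b, c}" and par: "a + c = b + d"
    and np: "\<And>a b c d. parallelogram a b c d \<Longrightarrow> S \<noteq> {a, b, c, d}"
      "\<And>a b c d e. parallelogram a b c d \<Longrightarrow> closed_segment a c \<inter> closed_segment b d = {e}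
        \<Longrightarrow> S \<noteq> {a, b, c, d, e}"
  shows "closure U = UNIV"
proof -
  have p: "parallelogram a b c d" using nc par by (simp add: parallelogram_iff)
  have "S \<noteq> {a, b, c, d, midpoint a c}" "S \<noteq> {a, b, c, d}"
    using np p diagonals_meet_in_midpoint[OF nc par] by blast+
  then obtain e where "e \<in> S" "e \<notin> {a, b, c, d, midpoint a c}" using mem by blast
  then show ?thesis
    using parallelogram_extra_dense[OF U _ _ _ _ _ par nc, of e] mem S by auto
qed

theorem corollary1p4:
  fixes S :: "(real^2) set"
  assumes "finite S"
  shows "closure (\<Union>i::nat. (line_intersections ^^ i) S) = UNIV \<longleftrightarrow>
    \<not> (S = {} \<or>
       collinear S \<or>
       (\<exists>A p. collinear A \<and> \<not> collinear (insert p A) \<and> S = insert p A) \<or>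
       (\<exists>a b c d. parallelogram a b c d \<and> S = {a, b, c, d}) \<or>
       (\<exists>a b c d e. parallelogram a b c d \<and>
          closed_segment a c \<inter> closed_segment b d = {e} \<and> S = {a, b, c, d, e}))"
    (is "?dense \<longleftrightarrow> \<not> ?exceptional")
proof
  show "\<not> ?exceptional" if ?dense
  proof
    have stable: "\<not> ?dense" if "S \<subseteq> E" "line_intersections E \<subseteq> E" "finite E" for E
      using iterates_not_dense[OF that] .
    assume ?exceptional
    then consider "collinear S" | A p where "collinear A" "S = insert p A"
      | a b c d where "parallelogram a b c d" "S = {a, b, c, d}"
      | a b c d e where "parallelogram a b c d" "closed_segment a c \<inter> closed_segment b d = {e}" "S = {a, b, c, d, e}"
      using collinear_empty by blast
    then have "\<not> ?dense"
    proof cases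
      case 1
      then show ?thesis
      proof (cases "S = {}")
        case True
        then show ?thesis using stable[of "{}"] by (auto simp: line_intersections_def connecting_lines_def)
      next
        case False
        then obtain p where "S = insert p S" by blast
        then show ?thesis using pencil_line_intersections[OF 1, of p] stable[of S] assms by simp
      qed
    next
      case (2 A p)
      then show ?thesis using pencil_line_intersections[of A p] stable[of S] assms by simp
    next
      case (3 a b c d)
      then show ?thesis
        using parallelogram_line_intersections[of a b c d] stable[of "{a, b, c, d, midpoint a c}"]
        by (auto simp: parallelogram_iff)
    next
      case (4 a b c d e)
      have "e = midpoint a c"
        using 4(1,2) diagonals_meet_in_midpoint[of a b c d] by (simp add: parallelogram_iff)
      then show ?thesis
        using parallelogram_line_intersections[of a b c d] stable[of S] 4 assms
        by (auto simp: parallelogram_iff)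
    qed
    then show False using that by blast
  qed
next
  assume ne: "\<not> ?exceptional"
  let ?U = "\<Union>i::nat. (line_intersections ^^ i) S"
  have nc: "\<not> collinear S" using ne by blast
  have U: "meet_closed ?U" by (rule meet_closed_iterates[OF nc])
  have SU: "S \<subseteq> ?U" using UN_upper[of 0 UNIV "\<lambda>i. (line_intersections ^^ i) S"] by simp
  obtain a b c d where mem: "a \<in> S" "b \<in> S" "c \<in> S" "d \<in> S"
    and q: "\<not> collinear {a, b, c}" "\<not> collinear {d, b, c}" "\<not> collinear {a, d, c}" "\<not> collinear {a, b, d}"
    by (rule quadrangle_or_pencil[OF nc]) (use ne in blast)+
  have par: "closure ?U = UNIV"
    if "a' \<in> S" "b' \<in> S" "c' \<in> S" "d' \<in> S" "\<not> collinear {a', b', c'}" "a' + c' = b' + d'" for a' b' c' d'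
    using parallelogram_superset_dense[OF U SU that] ne by blast
  show ?dense
  proof (cases "a + c = b + d \<or> a + b = c + d \<or> b + c = a + d")
    case True
    then show ?thesis
      using par[of a b c d] par[of a c b d] par[of b a c d] mem q by (auto simp: insert_commute)
  next
    case False
    have mU: "a \<in> ?U" "b \<in> ?U" "c \<in> ?U" "d \<in> ?U" using SU mem by blast+
    show ?thesis using quadrangle_dense[OF U mU q] False by blast
  qed
qed

end
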